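(* Let $l>1$, let $X\subset\mathbb{R}^l$ be a nonempty finite set, let $f:\mathbb{R}^l\to\mathbb{R}$ be continuous, and let $\mathbf{G}=(g_0,\dots,g_n)^T:X\to\mathbb{R}^{n+1}$ and $\mathbf{H}=(h_0,\dots,h_m)^T:X\to\mathbb{R}^{m+1}$ be given. Fix $z\in\mathbb{R}$ and $\delta>0$. Consider the linear programming problem in the variables $(\mathbf{A},\mathbf{B},\tilde u)\in\mathbb{R}^{n+1}\times\mathbb{R}^{m+1}\times\mathbb{R}$: minimise $\tilde u$ subject to, for all $\mathbf{x}\in X$, $$f(\mathbf{x})\,\mathbf{B}^T\mathbf{H}(\mathbf{x})-\mathbf{A}^T\mathbf{G}(\mathbf{x})\le z\,\mathbf{B}^T\mathbf{H}(\mathbf{x})+\tilde u,$$ $$\mathbf{A}^T\mathbf{G}(\mathbf{x})-f(\mathbf{x})\,\mathbf{B}^T\mathbf{H}(\mathbf{x})\le z\,\mathbf{B}^T\mathbf{H}(\mathbf{x})+\tilde u,$$ $$\mathbf{B}^T\mathbf{H}(\mathbf{x})\ge\delta.$$ If the optimal value of this problem is $\le 0$, then there exists $(\mathbf{A},\mathbf{B})\in\mathbb{R}^{n+1}\times\mathbb{R}^{m+1}$ such that, for all $\mathbf{x}\in X$, $$\mathbf{B}^T\mathbf{H}(\mathbf{x})>0,\qquad f(\mathbf{x})-\frac{\mathbf{A}^T\mathbf{G}(\mathbf{x})}{\mathbf{B}^T\mathbf{H}(\mathbf{x})}\le z,\qquad \frac{\mathbf{A}^T\mathbf{G}(\mathbf{x})}{\mathbf{B}^T\mathbf{H}(\mathbf{x})}-f(\mathbf{x})\le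 z;$$ otherwise no such $(\mathbf{A},\mathbf{B})$ exists.
   Context: The optimal value of the linear programming problem is the infimum of $\tilde u$ over all feasible $(\mathbf{A},\mathbf{B},\tilde u)$, taken in $[-\infty,+\infty]$: it is $-\infty$ if the problem is unbounded below and $+\infty$ if the problem has no feasible point. The functions $g_i,h_j$ are the basis functions of a multivariate generalised rational approximation and are not required to be monomials. *)

theory Defs
  imports "HOL-Analysis.Analysis" "HOL-Library.Extended_Real"
begin

text \<open>
  Index sets: \<open>{0..n}\<close> and \<open>{0..m}\<close> are represented by finite types \<open>'n\<close> and \<open>'m\<close>, so
  \<open>CARD('n) = n + 1\<close> and \<open>CARD('m) = m + 1\<close>; since types are nonempty, \<open>n\<close> and \<open>m\<close> range over
  all natural numbers.  The basis functions are total, but only their values on \<open>X\<close> are used.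
\<close>

definition lp_feasible ::
  "(real ^ 'l) set \<Rightarrow> (real ^ 'l \<Rightarrow> real) \<Rightarrow> (real ^ 'l \<Rightarrow> real ^ 'n) \<Rightarrow> (real ^ 'l \<Rightarrow> real ^ 'm)
    \<Rightarrow> real \<Rightarrow> real \<Rightarrow> ((real ^ 'n) \<times> (real ^ 'm) \<times> real) set"
  where
  "lp_feasible X f G H z \<delta> =
    {(A, B, u). \<forall>x\<in>X.
       f x * (B \<bullet> H x) - A \<bullet> G x \<le> z * (B \<bullet> H x) + u \<and>
       A \<bullet> G x - f x * (B \<bullet> H x) \<le> z * (B \<bullet> H x) + u \<and>
       B \<bullet> H x \<ge> \<delta>}"

text \<open>The infimum is taken in \<^typ>\<open>ereal\<close>, so it is \<open>\<infinity>\<close> when there is no feasible point.\<close>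

definition lp_value ::
  "(real ^ 'l) set \<Rightarrow> (real ^ 'l \<Rightarrow> real) \<Rightarrow> (real ^ 'l \<Rightarrow> real ^ 'n) \<Rightarrow> (real ^ 'l \<Rightarrow> real ^ 'm)
    \<Rightarrow> real \<Rightarrow> real \<Rightarrow> ereal"
  where
  "lp_value X f G H z \<delta> = (INF (A, B, u) \<in> lp_feasible X f G H z \<delta>. ereal u)"

definition rational_level_solution ::
  "(real ^ 'l) set \<Rightarrow> (real ^ 'l \<Rightarrow> real) \<Rightarrow> (real ^ 'l \<Rightarrow> real ^ 'n) \<Rightarrow> (real ^ 'l \<Rightarrow> real ^ 'm)
    \<Rightarrow> real \<Rightarrow> real ^ 'n \<Rightarrow> real ^ 'm \<Rightarrow> bool"
  where
  "rational_level_solution X f G H z A B \<longleftrightarrow>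
    (\<forall>x\<in>X. B \<bullet> H x > 0 \<and>
       f x - (A \<bullet> G x) / (B \<bullet> H x) \<le> z \<and>
       (A \<bullet> G x) / (B \<bullet> H x) - f x \<le> z)"

end

theory Submission
  imports Defs
begin

text \<open>
  Multiplying the level conditions by the positive denominator \<open>B \<bullet> H x\<close> turns them into the
  constraints of the linear programme at \<open>u = 0\<close>, except that the programme asks for
  \<open>B \<bullet> H x \<ge> \<delta>\<close> instead of positivity.  The level conditions are invariant under scaling
  \<open>(A, B)\<close> by a positive factor, and \<open>X\<close> is finite, so this makes no difference: a solution at
  level \<open>z\<close> is the same thing, up to scaling, as a feasible point with \<open>u = 0\<close>.

  The delicate case is that of optimal value exactly \<open>0\<close>, where the definition of the infimum
  only provides feasible points with \<open>u\<close> below every positive \<open>\<epsilon>\<close>.  That the value is attained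
  is special to linear constraints; the feasible set is unbounded, so compactness does not yield
  it.  Attainment follows from \<open>approximately_solvable_imp_solvable\<close>: a finite system of linear
  inequalities that is solvable up to every \<open>\<epsilon> > 0\<close> is solvable.  That lemma is a form of
  Farkas' lemma and rests on the closedness of finitely generated convex cones.
\<close>

section \<open>Approximate solvability of linear inequalities\<close>

text \<open>
  The constant term of a strictly separating hyperplane can be moved to \<open>0\<close>: a point of the
  cone on the negative side of the parallel hyperplane through the origin has a multiple on the
  separating hyperplane.
\<close>

lemma closed_convex_cone_separate_point:
  fixes K :: "'a::euclidean_space set"
  assumes "convex_cone K" "closed K" "p \<notin> K"
  shows "\<exists>n. n \<bullet> p < 0 \<and> (\<forall>k\<in>K. n \<bullet> k \<ge> 0)"
proof -
  obtain n b where n: "n \<bullet> p < b" "\<And>k. k \<in> K \<Longrightarrow> n \<bullet> k > b"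
    using separating_hyperplane_closed_point[of K p] assms by (auto simp: convex_cone_def)
  have "b < 0"
    using n(2)[of 0] assms(1) by (simp add: convex_cone_iff)
  have "n \<bullet> k \<ge> 0" if "k \<in> K" for k
  proof (rule ccontr)
    assume neg: "\<not> n \<bullet> k \<ge> 0"
    then have "b / (n \<bullet> k) \<ge> 0"
      using \<open>b < 0\<close> by (simp add: divide_nonpos_neg)
    then have "(b / (n \<bullet> k)) *\<^sub>R k \<in> K"
      using assms(1) that by (simp add: convex_cone_scaleR)
    from n(2)[OF this] show False
      using neg by simp
  qed
  with n(1) \<open>b < 0\<close> show ?thesis
    by (intro exI[of _ n]) auto
qed

text \<open>
  A pair \<open>(a, b)\<close> in \<open>S\<close> stands for the inequality \<open>a \<bullet> v \<le> b\<close>.  The convex cone generated by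
  \<open>S\<close> and \<open>(0, 1)\<close> consists of inequalities implied by the system.  It is closed because \<open>S\<close> is
  finite, so if it avoids the absurd inequality \<open>(0, -1)\<close>, then a hyperplane through the origin
  separates it from that point, and the normal vector, scaled so that its last component is
  \<open>1\<close>, is \<open>(-v, 1)\<close> for a solution \<open>v\<close>.  Approximate solvability excludes \<open>(0, -1)\<close>: an element
  of the cone remains implied when the system is relaxed by \<open>\<epsilon>\<close>, up to an error linear in \<open>\<epsilon>\<close>.
\<close>

lemma approximately_solvable_imp_solvable:
  fixes S :: "('a::euclidean_space \<times> real) set"
  assumes "finite S"
    and approx: "\<And>\<epsilon>. \<epsilon> > 0 \<Longrightarrow> \<exists>v. \<forall>(a, b)\<in>S. a \<bullet> v \<le> b + \<epsilon>"
  shows "\<exists>v. \<forall>(a, b)\<in>S. a \<bullet> v \<le> b"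
proof -
  define K where "K = convex_cone hull (insert (0, 1) S)"
  \<comment> \<open>\<open>M\<close> plays the part of the sum of the multipliers of the inequalities in \<open>S\<close>; that
    \<open>C\<close> is itself a convex cone avoids explicit conic combinations.\<close>
  define implied where "implied M p q \<longleftrightarrow>
    (\<forall>\<epsilon>>0. \<forall>v. (\<forall>(a, b)\<in>S. a \<bullet> v \<le> b + \<epsilon>) \<longrightarrow> p \<bullet> v \<le> q + M * \<epsilon>)" for M p q
  define C where "C = {(p, q). \<exists>M\<ge>0. implied M p q}"
  have CI: "(p, q) \<in> C" if "M \<ge> 0" "implied M p q" for p q M
    using that unfolding C_def by blast
  have "K \<subseteq> C"
    unfolding K_def
  proof (rule hull_minimal)
    have "(0, 1) \<in> C" "(0, 0) \<in> C"
      by (auto intro!: CI[of 0] simp: implied_def)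
    have "(a, b) \<in> C" if "(a, b) \<in> S" for a b
      using that by (intro CI[of 1]) (auto simp: implied_def)
    with \<open>(0, 1) \<in> C\<close> show "insert (0, 1) S \<subseteq> C"
      by auto
    have "x + y \<in> C" if "x \<in> C" "y \<in> C" for x y
    proof -
      obtain p q M where x: "x = (p, q)" "M \<ge> 0" "implied M p q"
        using \<open>x \<in> C\<close> by (auto simp: C_def)
      obtain p' q' M' where y: "y = (p', q')" "M' \<ge> 0" "implied M' p' q'"
        using \<open>y \<in> C\<close> by (auto simp: C_def)
      have "implied (M + M') (p + p') (q + q')"
        unfolding implied_def
      proof (intro allI impI)
        fix \<epsilon> :: real and v
        assume "\<epsilon> > 0" "\<forall>(a, b)\<in>S. a \<bullet> v \<le> b + \<epsilon>"
        then have "p \<bullet> v \<le> q + M * \<epsilon>" "p' \<bullet> v \<le> q' + M' * \<epsilon>"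
          using x(3) y(3) unfolding implied_def by blast+
        then show "(p + p') \<bullet> v \<le> q + q' + (M + M') * \<epsilon>"
          by (simp add: inner_add_left algebra_simps)
      qed
      with x(2) y(2) show ?thesis
        unfolding x(1) y(1) by (simp add: CI[of "M + M'"])
    qed
    moreover have "c *\<^sub>R x \<in> C" if "x \<in> C" "c \<ge> 0" for x c
    proof -
      obtain p q M where x: "x = (p, q)" "M \<ge> 0" "implied M p q"
        using \<open>x \<in> C\<close> by (auto simp: C_def)
      have "implied (c * M) (c *\<^sub>R p) (c * q)"
        unfolding implied_def
      proof (intro allI impI)
        fix \<epsilon> :: real and v
        assume "\<epsilon> > 0" "\<forall>(a, b)\<in>S. a \<bullet> v \<le> b + \<epsilon>"
        then have "p \<bullet> v \<le> q + M * \<epsilon>"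
          using x(3) unfolding implied_def by blast
        from mult_left_mono[OF this \<open>c \<ge> 0\<close>] show "(c *\<^sub>R p) \<bullet> v \<le> c * q + c * M * \<epsilon>"
          by (simp add: algebra_simps)
      qed
      with x(2) \<open>c \<ge> 0\<close> show ?thesis
        unfolding x(1) by (simp add: CI[of "c * M"])
    qed
    ultimately show "convex_cone C"
      using \<open>(0, 0) \<in> C\<close> by (auto simp: convex_cone_iff zero_prod_def)
  qed
  have "(0, -1) \<notin> K"
  proof
    assume "(0, -1) \<in> K"
    with \<open>K \<subseteq> C\<close> obtain M where M: "M \<ge> 0" "implied M 0 (-1)"
      by (auto simp: C_def)
    define \<epsilon> where "\<epsilon> = 1 / (M + 1)"
    have "\<epsilon> > 0" "M * \<epsilon> < 1"
      using M(1) by (auto simp: \<epsilon>_def field_simps)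
    obtain v where "\<forall>(a, b)\<in>S. a \<bullet> v \<le> b + \<epsilon>"
      using approx \<open>\<epsilon> > 0\<close> by blast
    with M(2) \<open>\<epsilon> > 0\<close> have "0 \<bullet> v \<le> -1 + M * \<epsilon>"
      unfolding implied_def by blast
    with \<open>M * \<epsilon> < 1\<close> show False
      by simp
  qed
  moreover have "closed K"
    unfolding K_def using \<open>finite S\<close> by (intro closed_convex_cone_hull) simp
  moreover have "convex_cone K"
    unfolding K_def by (rule convex_cone_convex_cone_hull)
  ultimately obtain n where n: "n \<bullet> (0, -1) < 0" "\<And>k. k \<in> K \<Longrightarrow> n \<bullet> k \<ge> 0"
    using closed_convex_cone_separate_point[of K "(0, -1)"] by meson
  obtain w s where ws: "n = (w, s)"
    by (cases n)
  have "s > 0"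
    using n(1) by (simp add: ws)
  have "a \<bullet> (- (w /\<^sub>R s)) \<le> b" if "(a, b) \<in> S" for a b
  proof -
    have "(a, b) \<in> K"
      unfolding K_def by (rule hull_inc) (use that in simp)
    from n(2)[OF this] show ?thesis
      using \<open>s > 0\<close> by (simp add: ws inner_commute field_simps)
  qed
  then show ?thesis
    by blast
qed

section \<open>Level solutions and feasible points\<close>

text \<open>
  Scaling a level solution preserves it, and a large enough factor lifts all denominators,
  finitely many positive numbers, above \<open>\<delta>\<close>.
\<close>

lemma level_solution_imp_feasible_zero:
  assumes "finite X" "X \<noteq> {}" "\<delta> > 0"
    and sol: "rational_level_solution X f G H z A B"
  shows "\<exists>t>0. (t *\<^sub>R A, t *\<^sub>R B, 0) \<in> lp_feasible X f G H z \<delta>"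
proof (intro exI conjI)
  define t where "t = Max ((\<lambda>x. \<delta> / (B \<bullet> H x)) ` X)"
  have pos: "B \<bullet> H x > 0" if "x \<in> X" for x
    using sol that by (auto simp: rational_level_solution_def)
  have t: "\<delta> / (B \<bullet> H x) \<le> t" if "x \<in> X" for x
    unfolding t_def using that \<open>finite X\<close> by (intro Max_ge) auto
  obtain x0 where "x0 \<in> X"
    using \<open>X \<noteq> {}\<close> by blast
  have "0 < \<delta> / (B \<bullet> H x0)"
    using \<open>\<delta> > 0\<close> pos[OF \<open>x0 \<in> X\<close>] by simp
  with t[OF \<open>x0 \<in> X\<close>] show "t > 0"
    by linarith
  show "(t *\<^sub>R A, t *\<^sub>R B, 0) \<in> lp_feasible X f G H z \<delta>"
    unfolding lp_feasible_def
  proof (clarsimp, intro conjI)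
    fix x assume "x \<in> X"
    have "f x * (B \<bullet> H x) - A \<bullet> G x \<le> z * (B \<bullet> H x)"
      and "A \<bullet> G x - f x * (B \<bullet> H x) \<le> z * (B \<bullet> H x)"
      using sol \<open>x \<in> X\<close> pos[OF \<open>x \<in> X\<close>] by (auto simp: rational_level_solution_def field_simps)
    from this[THEN mult_left_mono[of _ _ t]] \<open>t > 0\<close>
    show "f x * (t * (B \<bullet> H x)) - t * (A \<bullet> G x) \<le> z * (t * (B \<bullet> H x))"
      and "t * (A \<bullet> G x) - f x * (t * (B \<bullet> H x)) \<le> z * (t * (B \<bullet> H x))"
      by (simp_all add: algebra_simps)
    show "\<delta> \<le> t * (B \<bullet> H x)"
      using t[OF \<open>x \<in> X\<close>] pos[OF \<open>x \<in> X\<close>] by (simp add: field_simps)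
  qed
qed

lemma feasible_zero_imp_level_solution:
  assumes "\<delta> > 0" and "(A, B, 0) \<in> lp_feasible X f G H z \<delta>"
  shows "rational_level_solution X f G H z A B"
  unfolding rational_level_solution_def
proof (intro ballI conjI)
  fix x assume "x \<in> X"
  with assms(2) have *: "f x * (B \<bullet> H x) - A \<bullet> G x \<le> z * (B \<bullet> H x)"
    "A \<bullet> G x - f x * (B \<bullet> H x) \<le> z * (B \<bullet> H x)" "\<delta> \<le> B \<bullet> H x"
    by (auto simp: lp_feasible_def)
  show pos: "B \<bullet> H x > 0"
    using *(3) \<open>\<delta> > 0\<close> by linarith
  show "f x - (A \<bullet> G x) / (B \<bullet> H x) \<le> z" "(A \<bullet> G x) / (B \<bullet> H x) - f x \<le> z"
    using *(1,2) pos by (simp_all add: field_simps)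
qed

text \<open>
  With \<open>u = 0\<close> fixed, feasibility is a finite system of linear inequalities in \<open>v = (A, B)\<close>,
  and feasible points with small \<open>u\<close> solve it approximately.
\<close>

lemma lp_value_le_zero_imp_feasible_zero:
  fixes X :: "(real ^ 'l) set"
    and G :: "real ^ 'l \<Rightarrow> real ^ 'n"
    and H :: "real ^ 'l \<Rightarrow> real ^ 'm"
  assumes "finite X" and value_le: "lp_value X f G H z \<delta> \<le> 0"
  shows "\<exists>A B. (A, B, 0) \<in> lp_feasible X f G H z \<delta>"
proof -
  define S :: "(((real ^ 'n) \<times> (real ^ 'm)) \<times> real) set" where
    "S = (\<Union>x\<in>X. {((- G x, (f x - z) *\<^sub>R H x), 0),
                  ((G x, (- f x - z) *\<^sub>R H x), 0),
                  ((0, - H x), - \<delta>)})"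
  have S_iff: "(\<forall>(a, b)\<in>S. a \<bullet> (A, B) \<le> b + \<epsilon>) \<longleftrightarrow>
      (\<forall>x\<in>X. f x * (B \<bullet> H x) - A \<bullet> G x \<le> z * (B \<bullet> H x) + \<epsilon> \<and>
             A \<bullet> G x - f x * (B \<bullet> H x) \<le> z * (B \<bullet> H x) + \<epsilon> \<and>
             \<delta> \<le> B \<bullet> H x + \<epsilon>)" for A B \<epsilon>
    unfolding S_def
    by (simp add: inner_commute[of "G _"] inner_commute[of "H _"] algebra_simps)
  have "\<exists>v. \<forall>(a, b)\<in>S. a \<bullet> v \<le> b + \<epsilon>" if "\<epsilon> > 0" for \<epsilon>
  proof -
    have "lp_value X f G H z \<delta> < ereal \<epsilon>"
      using value_le that by (simp add: le_less_trans)
    then obtain A B u where "(A, B, u) \<in> lp_feasible X f G H z \<delta>" "u < \<epsilon>"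
      unfolding lp_value_def by (auto simp: INF_less_iff)
    then have "\<forall>(a, b)\<in>S. a \<bullet> (A, B) \<le> b + \<epsilon>"
      unfolding S_iff lp_feasible_def using that by fastforce
    then show ?thesis
      by blast
  qed
  moreover have "finite S"
    using \<open>finite X\<close> by (simp add: S_def)
  ultimately obtain A B where "\<forall>(a, b)\<in>S. a \<bullet> (A, B) \<le> b"
    using approximately_solvable_imp_solvable[of S] by force
  then show ?thesis
    using S_iff[of A B 0] by (auto simp: lp_feasible_def)
qed

theorem mainTheorem2:
  fixes X :: "(real ^ 'l) set"
    and f :: "real ^ 'l \<Rightarrow> real"
    and G :: "real ^ 'l \<Rightarrow> real ^ 'n"
    and H :: "real ^ 'l \<Rightarrow> real ^ 'm"
    and z \<delta> :: real
  assumes "CARD('l) > 1"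
    and "finite X" and "X \<noteq> {}"
    and "continuous_on UNIV f"
    and "\<delta> > 0"
  shows "(lp_value X f G H z \<delta> \<le> 0 \<longrightarrow> (\<exists>A B. rational_level_solution X f G H z A B)) \<and>
    (\<not> lp_value X f G H z \<delta> \<le> 0 \<longrightarrow> \<not> (\<exists>A B. rational_level_solution X f G H z A B))"
proof (intro conjI impI notI)
  assume "lp_value X f G H z \<delta> \<le> 0"
  then show "\<exists>A B. rational_level_solution X f G H z A B"
    using lp_value_le_zero_imp_feasible_zero[OF \<open>finite X\<close>]
      feasible_zero_imp_level_solution[OF \<open>\<delta> > 0\<close>] by meson
next
  assume gt: "\<not> lp_value X f G H z \<delta> \<le> 0" and "\<exists>A B. rational_level_solution X f G H z A B"
  then obtain A B where "(A, B, 0) \<in> lp_feasible X f G H z \<delta>"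
    using level_solution_imp_feasible_zero[OF \<open>finite X\<close> \<open>X \<noteq> {}\<close> \<open>\<delta> > 0\<close>] by meson
  then have "lp_value X f G H z \<delta> \<le> ereal 0"
    unfolding lp_value_def by (rule INF_lower2) simp
  with gt show False
    by (simp add: zero_ereal_def)
qed

end
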